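(* Let $A:\mathbb{R}^n\to\mathbb{R}^m$ be linear, $\mathcal{C}\subseteq\mathbb{R}^n$ a nonempty closed convex set, $f:\mathbb{R}^n\to\mathbb{R}$ continuously differentiable, and $g:\mathbb{R}^m\to\mathbb{R}\cup\{\infty\}$ polyhedral convex, with $\mathrm{dom}\,g\cap A(\mathrm{ri}(\mathcal{C}))\neq\emptyset$. Let $(\bar x,\bar\lambda)\in\mathbb{R}^n\times\mathbb{R}^m$ satisfy: (i) $0\in\partial\delta_{\mathcal{C}}(\bar x)+\nabla f(\bar x)+A^\top\bar\lambda$ and $\bar\lambda\in\partial g(A\bar x)$; (ii) there exists a convex neighborhood $U_{\bar x}$ of $\bar x$ on which $\nabla^2 f$ exists and is continuous, and $\nabla^2 f(\bar x)$ is positive definite relative to the subspace $V_{\mathcal{C}}\cap\mathcal{S}_A(\bar x\mid\bar\lambda)$. Then there exists $\beta_0>0$ such that for any $\beta\ge\beta_0$ there exists a convex neighborhood $\mathcal{X}_\beta\times\Lambda_\beta$ of $(\bar x,\bar\lambda)$ with the following property: if $y^k\in\mathrm{dom}\,g$, $\lambda^k\in\Lambda_\beta\cap\partial g(y^k)$, and $$x^{k+1}\in\arg\min_{x\in\mathcal{C}} f(x)+\langle\lambda^k,Ax\rangle+\tfrac{\beta}{2}\|Ax-y^k\|^2$$ lies in $\mathcal{X}_\beta$, then with $$y^{k+1}=\arg\min_y g(y)+\langle\lambda^k,-y\rangle+\tfrac{\beta}{2}\|Ax^{k+1}-y\|^2,\qquad \lambda^{k+1}=\lambda^k+\beta(Ax^{k+1}-y^{k+1}),$$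 one has, for every saddle point $(\bar x,\lambda^* )$ of $l_{\beta_0}$ relative to $\mathcal{X}_\beta\times\Lambda_\beta$ and every $\theta\in(0,1)$, with $\bar y=A\bar x$, $$\begin{aligned} &l_{\beta_0}(x^{k+1},\lambda^* )-l_{\beta_0}(\bar x,\lambda^* )+\frac{\theta\beta-\beta_0}{2}(x^{k+1}-\bar x)^\top A^\top PA(x^{k+1}-\bar x)\\ \le{}&\frac{\beta}{2}\bigl(\|y^k-\bar y\|^2-\|y^{k+1}-\bar y\|^2\bigr)+\frac{1}{2\beta}\bigl(\|\lambda^k-\lambda^*\|^2-\|\lambda^{k+1}-\lambda^*\|^2\bigr)\\ &-\frac{\beta}{2}\|y^{k+1}-y^k\|^2-\frac{(1-\theta)\beta-\beta_0}{2\beta^2}\|\lambda^{k+1}-\lambda^k\|^2 . \end{aligned}$$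
   Context: $\delta_{\mathcal{C}}$ is the indicator function of $\mathcal{C}$; $\partial$ is the convex subdifferential (so $\partial\delta_{\mathcal{C}}(x)=N_{\mathcal{C}}(x)$, the normal cone). A polyhedral convex function is a convex function whose epigraph is a polyhedral convex set. $V_{\mathcal{C}}=\mathrm{aff}_{\mathcal{C}}-x$ (any $x\in\mathcal{C}$) is the linear subspace parallel to the affine hull of $\mathcal{C}$. For $\lambda\in\partial g(y)$, $T_g(y\mid\lambda):=\{w\mid g'(y;w)=\langle\lambda,w\rangle\}$ with $g'(y;w)$ the one-sided directional derivative; $\mathcal{S}(y\mid\lambda):=T_g(y\mid\lambda)-T_g(y\mid\lambda)$ (the set of differences, the smallest subspace containing the cone $T_g(y\mid\lambda)$); $\mathcal{S}_A(\bar x\mid\bar\lambda):=\{v\in\mathbb{R}^n\mid Av\in\mathcal{S}(A\bar x\mid\bar\lambda)\}$. A symmetric matrix $H$ is positive definite relative to a subspace $V$ if $v^\top Hv>0$ for all $0\neq v\in V$. $P:=I-\Pi_{\mathcal{S}(A\bar x\mid\bar\lambda)}$, where $\Pi_{\mathcal{S}}$ is the orthogonal projection onto $\mathcal{S}$. For $\beta>0$, $M^{1/\beta}_g(w)=\inf_y\{g(y)+\frac{\beta}{2}\|y-w\|^2\}$ and the reduced augmented Lagrangian is $$l_\beta(x,\lambda)=f(x)+M^{1/\beta}_g\bigl(Ax+\tfrac{\lambda}{\beta}\bigr)+\delta_{\mathcal{C}}(x)-\tfrac{1}{2\beta}\|\lambda\|^2.$$ A point $(x^*,\lambda^* )\in\mathcal{X}\times\Lambda$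 is a saddle point of $l$ relative to $\mathcal{X}\times\Lambda$ if $l(x^*,\lambda)\le l(x^*,\lambda^* )\le l(x,\lambda^* )$ for all $x\in\mathcal{X}$, $\lambda\in\Lambda$. *)

theory Defs
  imports "HOL-Analysis.Analysis"
begin

definition edom :: "('a \<Rightarrow> ereal) \<Rightarrow> 'a set" where
  "edom h = {x. h x < \<infinity>}"

definition epi :: "('a \<Rightarrow> ereal) \<Rightarrow> ('a \<times> real) set" where
  "epi h = {(x, t). h x \<le> ereal t}"

text \<open>A polyhedron is a finite intersection of half-spaces, so it is convex and
  convexity of the function need not be required separately.\<close>

definition polyhedral_convex :: "('a::euclidean_space \<Rightarrow> ereal) \<Rightarrow> bool" where
  "polyhedral_convex h \<longleftrightarrow> polyhedron (epi h)"

definition indicator_fn :: "'a set \<Rightarrow> 'a \<Rightarrow> ereal" where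
  "indicator_fn C x = (if x \<in> C then 0 else \<infinity>)"

text \<open>The subdifferential is empty at points where the function is not finite.\<close>

definition subdiff :: "('a::real_inner \<Rightarrow> ereal) \<Rightarrow> 'a \<Rightarrow> 'a set" where
  "subdiff h x =
     {v. \<bar>h x\<bar> \<noteq> \<infinity> \<and> (\<forall>z. h x + ereal (v \<bullet> (z - x)) \<le> h z)}"

text \<open>Intended for convex \<open>h\<close> finite at \<open>y\<close>, where the difference quotient is
  monotone in \<open>t\<close> and so the limit exists in the extended reals.\<close>

definition dir_deriv :: "('a::real_vector \<Rightarrow> ereal) \<Rightarrow> 'a \<Rightarrow> 'a \<Rightarrow> ereal" where
  "dir_deriv h y w = Lim (at_right 0) (\<lambda>t. (h (y + t *\<^sub>R w) - h y) / ereal t)"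

definition T_cone :: "('a::real_inner \<Rightarrow> ereal) \<Rightarrow> 'a \<Rightarrow> 'a \<Rightarrow> 'a set" where
  "T_cone g y l = {w. dir_deriv g y w = ereal (l \<bullet> w)}"

definition S_space :: "('a::real_inner \<Rightarrow> ereal) \<Rightarrow> 'a \<Rightarrow> 'a \<Rightarrow> 'a set" where
  "S_space g y l = {a - b |a b. a \<in> T_cone g y l \<and> b \<in> T_cone g y l}"

definition S_space_pre ::
  "(real^'m \<Rightarrow> ereal) \<Rightarrow> real^'n^'m \<Rightarrow> real^'n \<Rightarrow> real^'m \<Rightarrow> (real^'n) set" where
  "S_space_pre g A x l = {v. A *v v \<in> S_space g (A *v x) l}"

text \<open>For each fixed \<open>x \<in> C\<close> the set of all \<open>u - x\<close> is the same, so letting \<open>x\<close> range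
  over \<open>C\<close> yields the translate of the affine hull by any single point of \<open>C\<close>.\<close>

definition parallel_space :: "'a::real_vector set \<Rightarrow> 'a set" where
  "parallel_space C = {u - x |u x. u \<in> affine hull C \<and> x \<in> C}"

definition pos_def_rel :: "real^'n^'n \<Rightarrow> (real^'n) set \<Rightarrow> bool" where
  "pos_def_rel H V \<longleftrightarrow> (\<forall>v\<in>V. v \<noteq> 0 \<longrightarrow> v \<bullet> (H *v v) > 0)"

definition orth_proj :: "'a::real_inner set \<Rightarrow> 'a \<Rightarrow> 'a" where
  "orth_proj S v = (THE p. p \<in> S \<and> (\<forall>s\<in>S. orthogonal (v - p) s))"

definition P_map :: "('a::real_inner \<Rightarrow> ereal) \<Rightarrow> 'a \<Rightarrow> 'a \<Rightarrow> 'a \<Rightarrow> 'a" where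
  "P_map g y l v = v - orth_proj (S_space g y l) v"

text \<open>The argument \<open>\<beta>\<close> is the reciprocal of the usual Moreau parameter.\<close>

definition moreau_env :: "real \<Rightarrow> ('a::real_normed_vector \<Rightarrow> ereal) \<Rightarrow> 'a \<Rightarrow> ereal" where
  "moreau_env \<beta> g w = (INF y. g y + ereal (\<beta> / 2 * (norm (y - w))\<^sup>2))"

definition reduced_aug_lagrangian ::
  "(real^'n \<Rightarrow> real) \<Rightarrow> (real^'m \<Rightarrow> ereal) \<Rightarrow> real^'n^'m \<Rightarrow> (real^'n) set \<Rightarrow>
    real \<Rightarrow> real^'n \<Rightarrow> real^'m \<Rightarrow> ereal" where
  "reduced_aug_lagrangian f g A C \<beta> x l =
     ereal (f x) + moreau_env \<beta> g (A *v x + l /\<^sub>R \<beta>) + indicator_fn C x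
       - ereal (1 / (2 * \<beta>) * (norm l)\<^sup>2)"

definition saddle_point ::
  "('a \<Rightarrow> 'b \<Rightarrow> ereal) \<Rightarrow> 'a set \<Rightarrow> 'b set \<Rightarrow> 'a \<Rightarrow> 'b \<Rightarrow> bool" where
  "saddle_point L X Y x y \<longleftrightarrow>
     x \<in> X \<and> y \<in> Y \<and> (\<forall>x'\<in>X. \<forall>y'\<in>Y. L x y' \<le> L x y \<and> L x y \<le> L x' y)"

definition convex_nbhd :: "'a::real_normed_vector \<Rightarrow> 'a set \<Rightarrow> bool" where
  "convex_nbhd x U \<longleftrightarrow> convex U \<and> x \<in> interior U"

end

theory Submission
  imports Defs
begin

text \<open>
  Why the inequality holds. Two facts replace the global convexity of \<open>f\<close> in the usual convergence
  estimate of the alternating direction method of multipliers.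

  The first concerns \<open>f\<close>. The subspace \<open>S_A\<close> is the kernel of \<open>P A\<close>, so the second-order condition says
  that the Hessian at \<open>xbar\<close> is positive definite on the kernel of \<open>P A\<close> inside \<open>V_C\<close>. A multiple
  \<open>\<beta>0\<close> of \<open>A\<^sup>T P A\<close> then makes it positive definite on all of \<open>V_C\<close>
  (\<open>penalty_gives_positive_definiteness\<close>), nonnegativity persists near \<open>xbar\<close>
  (\<open>penalized_hessian_nonneg_near\<close>), and along segments from \<open>xbar\<close> into \<open>C\<close> the function \<open>f\<close> obeys
  the gradient inequality of a convex function up to \<open>\<beta>0 / 2\<close> times the squared norm of
  \<open>P A (x1 - xbar)\<close> (\<open>local_gradient_inequality\<close>). This \<open>\<beta>0\<close> is the constant of the theorem.

  The second concerns \<open>g\<close>. The new multiplier \<open>l1\<close> is a subgradient of \<open>g\<close> at \<open>y1\<close>, and it is close to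
  \<open>lbar\<close> when \<open>lk\<close> and \<open>x1\<close> are close to \<open>lbar\<close> and \<open>xbar\<close>. Because the epigraph of \<open>g\<close> has only finitely
  many faces, \<open>lbar\<close> itself must be a subgradient at \<open>y1\<close> (\<open>polyhedral_subgradient_stable\<close>), which puts
  \<open>y1 - A xbar\<close> into the critical cone (\<open>common_subgradient_diff_in_S_space\<close>). Hence \<open>P\<close> annihilates
  \<open>y1 - A xbar\<close>, and \<open>P A (x1 - xbar)\<close> equals \<open>P\<close> applied to the residual \<open>A x1 - y1\<close>. The error
  term from \<open>f\<close> is therefore controlled by the squared length of \<open>l1 - lk\<close>, which is \<open>\<beta>\<close> times the
  residual.

  The rest is the classical computation (\<open>admm_descent_inequality\<close>) from the optimality conditions of the
  two subproblems. The reduced augmented Lagrangian enters through an upper bound at \<open>x1\<close>, obtained by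
  inserting \<open>y1\<close> into the Moreau envelope, and a lower bound at \<open>xbar\<close>: a saddle point has there at
  least the value for \<open>lbar\<close>, which is at least \<open>f xbar + g (A xbar)\<close>.
\<close>

section \<open>Subgradients and the epigraph\<close>

text \<open>Testing the subgradient inequality against real points of the epigraph removes all
  extended-real arithmetic: a subgradient \<open>v\<close> is a supporting functional \<open>(- v, 1)\<close> of the
  epigraph.\<close>

lemma subdiff_iff_epi:
  "v \<in> subdiff h y \<longleftrightarrow>
     \<bar>h y\<bar> \<noteq> \<infinity> \<and> (\<forall>(z, t) \<in> epi h. real_of_ereal (h y) + v \<bullet> (z - y) \<le> t)"
proof (cases "h y")
  case (real r)
  have "h y + ereal (v \<bullet> (z - y)) \<le> h z \<longleftrightarrow> (\<forall>t. (z, t) \<in> epi h \<longrightarrow> r + v \<bullet> (z - y) \<le> t)" for z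
  proof
    assume "h y + ereal (v \<bullet> (z - y)) \<le> h z"
    then have "ereal (r + v \<bullet> (z - y)) \<le> h z" by (simp add: real)
    then show "\<forall>t. (z, t) \<in> epi h \<longrightarrow> r + v \<bullet> (z - y) \<le> t"
      unfolding epi_def by (metis (lifting) case_prod_conv ereal_less_eq(3) mem_Collect_eq order.trans)
  next
    assume *: "\<forall>t. (z, t) \<in> epi h \<longrightarrow> r + v \<bullet> (z - y) \<le> t"
    have "ereal (r + v \<bullet> (z - y)) \<le> h z"
      by (rule ereal_le_real) (use * in \<open>auto simp: epi_def\<close>)
    then show "h y + ereal (v \<bullet> (z - y)) \<le> h z" by (simp add: real)
  qed
  then show ?thesis
    by (auto simp: subdiff_def real)
qed (auto simp: subdiff_def)

lemma mem_epi_finite: "\<bar>h y\<bar> \<noteq> \<infinity> \<Longrightarrow> (y, t) \<in> epi h \<longleftrightarrow> real_of_ereal (h y) \<le> t"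
  by (cases "h y") (auto simp: epi_def)

lemma subdiff_finite: "v \<in> subdiff h y \<Longrightarrow> \<bar>h y\<bar> \<noteq> \<infinity>"
  by (simp add: subdiff_def)

lemma subdiff_epiD:
  "v \<in> subdiff h y \<Longrightarrow> (z, t) \<in> epi h \<Longrightarrow> real_of_ereal (h y) + v \<bullet> (z - y) \<le> t"
  by (auto simp: subdiff_iff_epi)

lemma subdiff_realD:
  assumes "v \<in> subdiff h y" "\<bar>h z\<bar> \<noteq> \<infinity>"
  shows "real_of_ereal (h y) + v \<bullet> (z - y) \<le> real_of_ereal (h z)"
  using subdiff_epiD[OF assms(1), of z "real_of_ereal (h z)"] mem_epi_finite[of h z, OF assms(2)] by simp

lemma subdiff_monotone:
  assumes "v \<in> subdiff h y" "v' \<in> subdiff h y'"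
  shows "(v - v') \<bullet> (y - y') \<ge> 0"
  using subdiff_realD[OF assms(1) subdiff_finite[OF assms(2)]]
    subdiff_realD[OF assms(2) subdiff_finite[OF assms(1)]]
  by (simp add: inner_diff_left inner_diff_right)

text \<open>The graph of \<open>h\<close> above the points where \<open>l\<close> is a subgradient is the face of the epigraph on
  which \<open>(- l, 1)\<close> is minimal. For each face \<open>F\<close>, the slopes that are minimal on all of \<open>F\<close> form a closed
  set \<open>D F\<close>, and a polyhedron has only finitely many faces. Hence the union of those \<open>D F\<close> that miss
  \<open>lb\<close> is closed, and a slope close to \<open>lb\<close> can expose only faces on which \<open>lb\<close> is minimal too. The
  radius does not depend on the point \<open>y\<close>.\<close>

lemma polyhedral_subgradient_stable:
  fixes h :: "'a::euclidean_space \<Rightarrow> ereal"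
  assumes "polyhedral_convex h"
  obtains \<epsilon> where "\<epsilon> > 0"
    "\<And>y l. l \<in> subdiff h y \<Longrightarrow> dist l lb < \<epsilon> \<Longrightarrow> lb \<in> subdiff h y"
proof -
  have poly: "polyhedron (epi h)" using assms by (simp add: polyhedral_convex_def)
  have cvx: "convex (epi h)" using poly by (rule polyhedron_imp_convex)
  define D where "D F = {l. \<forall>u\<in>F. \<forall>z\<in>epi h. (- l, 1::real) \<bullet> u \<le> (- l, 1) \<bullet> z}" for F
  have closedD: "closed (D F)" for F
  proof -
    have "D F = (\<Inter>u\<in>F. \<Inter>z\<in>epi h. {l. (- l, 1::real) \<bullet> u \<le> (- l, 1) \<bullet> z})"
      by (auto simp: D_def)
    also have "closed \<dots>"
      by (intro closed_INT ballI closed_Collect_le continuous_intros)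
    finally show ?thesis .
  qed
  \<comment> \<open>the slopes to be avoided: those minimal on some face on which \<open>lb\<close> is not\<close>
  define W where "W = (\<Union>F \<in> {F. F face_of epi h \<and> lb \<notin> D F}. D F)"
  have "closed W" unfolding W_def
    using closedD by (intro closed_UN ballI finite_subset[OF _ finite_polyhedron_faces[OF poly]]) auto
  moreover have "lb \<notin> W" by (auto simp: W_def)
  ultimately obtain \<epsilon> where e: "\<epsilon> > 0" "ball lb \<epsilon> \<subseteq> - W"
    by (metis ComplI open_Compl open_contains_ball)
  show ?thesis
  proof (rule that[OF e(1)])
    fix y l assume l: "l \<in> subdiff h y" and near: "dist l lb < \<epsilon>"
    define r where "r = real_of_ereal (h y)"
    define F where "F = epi h \<inter> {u. (- l, 1::real) \<bullet> u = r - l \<bullet> y}"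
    have ge: "r - l \<bullet> y \<le> (- l, 1) \<bullet> u" if "u \<in> epi h" for u
      using subdiff_epiD[OF l, of "fst u" "snd u"] that
      by (cases u) (simp add: r_def inner_diff_right)
    have "F face_of epi h"
      unfolding F_def by (rule face_of_Int_supporting_hyperplane_ge[OF cvx ge])
    moreover have "l \<in> D F" using ge by (auto simp: D_def F_def)
    moreover have "l \<notin> W" using near e(2) by (metis ComplD dist_commute mem_ball subsetD)
    ultimately have lbD: "lb \<in> D F" by (auto simp: W_def)
    have "(y, r) \<in> F"
      using mem_epi_finite[of h y, OF subdiff_finite[OF l]] by (simp add: F_def r_def)
    then have "(- lb, 1::real) \<bullet> (y, r) \<le> (- lb, 1) \<bullet> z" if "z \<in> epi h" for z
      using lbD that by (auto simp: D_def)
    then show "lb \<in> subdiff h y"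
      using subdiff_finite[OF l]
      by (auto simp: subdiff_iff_epi r_def[symmetric] inner_diff_right algebra_simps)
  qed
qed

section \<open>The critical cone and the subspace it spans\<close>

lemma convex_epi_segment:
  assumes "convex (epi h)" "(y, r) \<in> epi h" "(y + t *\<^sub>R w, r + t * c) \<in> epi h" "0 < s" "s \<le> t"
  shows "(y + s *\<^sub>R w, r + s * c) \<in> epi h"
proof -
  have t: "t > 0" using assms by simp
  have "(1 - s / t) *\<^sub>R (y, r) + (s / t) *\<^sub>R (y + t *\<^sub>R w, r + t * c) \<in> epi h"
    using assms by (intro convexD) auto
  also have "(1 - s / t) *\<^sub>R (y, r) + (s / t) *\<^sub>R (y + t *\<^sub>R w, r + t * c) = (y + s *\<^sub>R w, r + s * c)"
    using t by (simp add: algebra_simps)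
  finally show ?thesis .
qed

lemma difference_quotient_le_iff:
  assumes "h y = ereal r" "t > 0"
  shows "(h (y + t *\<^sub>R w) - h y) / ereal t \<le> ereal c \<longleftrightarrow> (y + t *\<^sub>R w, r + t * c) \<in> epi h"
  using assms by (cases "h (y + t *\<^sub>R w)") (auto simp: epi_def field_simps)

text \<open>The difference quotient of a convex function is nondecreasing in the step length, so its limit at
  zero exists and is its infimum. Without this, \<open>Lim\<close> would denote an arbitrary value and nothing
  could be read off from membership in \<open>T_cone\<close>.\<close>

lemma dir_deriv_eq_INF:
  assumes "convex (epi h)" "h y = ereal r"
  shows "dir_deriv h y w = (INF t\<in>{0<..}. (h (y + t *\<^sub>R w) - h y) / ereal t)"
proof -
  let ?q = "\<lambda>t. (h (y + t *\<^sub>R w) - h y) / ereal t"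
  have yr: "(y, r) \<in> epi h" using assms by (simp add: epi_def)
  have mono: "?q s \<le> ?q t" if "0 < s" "s \<le> t" for s t
  proof (rule ereal_le_real)
    fix c assume "?q t \<le> ereal c"
    then have "(y + t *\<^sub>R w, r + t * c) \<in> epi h"
      using difference_quotient_le_iff[of h y r t w c, OF assms(2)] that by simp
    then have "(y + s *\<^sub>R w, r + s * c) \<in> epi h"
      using convex_epi_segment[OF assms(1) yr] that by blast
    then show "?q s \<le> ereal c"
      using difference_quotient_le_iff[of h y r s w c, OF assms(2)] that by simp
  qed
  have "(?q \<longlongrightarrow> (INF t\<in>{0<..}. ?q t)) (at_right 0)"
  proof (rule order_tendstoI)
    fix a assume a: "a < (INF t\<in>{0<..}. ?q t)"
    have "a < ?q t" if "t > 0" for t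
      by (rule less_le_trans[OF a]) (use that in \<open>auto intro: INF_lower\<close>)
    then show "\<forall>\<^sub>F t in at_right 0. a < ?q t"
      using eventually_at_right_less[of 0] by (rule eventually_mono[rotated])
  next
    fix a assume "(INF t\<in>{0<..}. ?q t) < a"
    then obtain t0 where t0: "t0 > 0" "?q t0 < a" by (auto simp: INF_less_iff)
    have "\<forall>\<^sub>F t in at_right 0. t \<in> {0<..<t0}"
      using t0(1) eventually_at_right_real by blast
    then show "\<forall>\<^sub>F t in at_right 0. ?q t < a"
    proof (rule eventually_mono)
      fix t assume "t \<in> {0<..<t0}"
      then show "?q t < a" using le_less_trans[OF mono[of t t0] t0(2)] by simp
    qed
  qed
  then show ?thesis
    unfolding dir_deriv_def by (intro tendsto_Lim) auto
qed

text \<open>A subgradient already bounds every difference quotient from below, so membership in the critical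
  cone only asks for steps whose slope is arbitrarily close to \<open>l \<bullet> w\<close>. This form consists of
  membership conditions on the convex set \<open>epi h\<close>, from which the cone properties follow.\<close>

lemma T_cone_iff:
  assumes "convex (epi h)" "l \<in> subdiff h y" "h y = ereal r"
  shows "w \<in> T_cone h y l \<longleftrightarrow> (\<forall>c > l \<bullet> w. \<exists>t>0. (y + t *\<^sub>R w, r + t * c) \<in> epi h)"
proof -
  let ?q = "\<lambda>t. (h (y + t *\<^sub>R w) - h y) / ereal t"
  have lower: "ereal (l \<bullet> w) \<le> ?q t" if "t > 0" for t
  proof (rule ereal_le_real)
    fix c assume "?q t \<le> ereal c"
    then have "(y + t *\<^sub>R w, r + t * c) \<in> epi h"
      using difference_quotient_le_iff[of h y r t w c, OF assms(3)] that by simp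
    from subdiff_epiD[OF assms(2) this] show "ereal (l \<bullet> w) \<le> ereal c"
      using that by (simp add: assms(3))
  qed
  have "w \<in> T_cone h y l \<longleftrightarrow> (INF t\<in>{0<..}. ?q t) = ereal (l \<bullet> w)"
    by (simp add: T_cone_def dir_deriv_eq_INF[OF assms(1,3)])
  also have "\<dots> \<longleftrightarrow> (INF t\<in>{0<..}. ?q t) \<le> ereal (l \<bullet> w)"
    using lower by (auto intro!: antisym INF_greatest)
  also have "\<dots> \<longleftrightarrow> (\<forall>c > l \<bullet> w. \<exists>t>0. ?q t \<le> ereal c)"
  proof
    assume le: "(INF t\<in>{0<..}. ?q t) \<le> ereal (l \<bullet> w)"
    show "\<forall>c > l \<bullet> w. \<exists>t>0. ?q t \<le> ereal c"
    proof (intro allI impI)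
      fix c assume "c > l \<bullet> w"
      with le have "(INF t\<in>{0<..}. ?q t) < ereal c" by (simp add: le_less_trans)
      then show "\<exists>t>0. ?q t \<le> ereal c" by (auto simp: INF_less_iff intro: less_imp_le)
    qed
  next
    assume *: "\<forall>c > l \<bullet> w. \<exists>t>0. ?q t \<le> ereal c"
    show "(INF t\<in>{0<..}. ?q t) \<le> ereal (l \<bullet> w)"
    proof (rule ereal_le_epsilon2)
      fix e :: real assume "e > 0"
      then have "l \<bullet> w + e > l \<bullet> w" by simp
      with * obtain t where "t > 0" "?q t \<le> ereal (l \<bullet> w + e)" by blast
      then show "(INF t\<in>{0<..}. ?q t) \<le> ereal (l \<bullet> w) + ereal e"
        by (auto intro: INF_lower2)
    qed
  qed
  finally show ?thesis
    using difference_quotient_le_iff[of h y r _ w, OF assms(3)] by (simp cong: conj_cong)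
qed

lemma S_spaceI: "a \<in> T_cone h y l \<Longrightarrow> b \<in> T_cone h y l \<Longrightarrow> a - b \<in> S_space h y l"
  by (auto simp: S_space_def)

text \<open>The critical cone is closed under addition because two admissible steps, shortened to a common
  length, can be averaged inside the epigraph. The differences of elements of a convex cone that
  contains zero form a subspace.\<close>

lemma subspace_S_space:
  assumes "convex (epi h)" "l \<in> subdiff h y"
  shows "subspace (S_space h y l)"
proof -
  obtain r where r: "h y = ereal r"
    using subdiff_finite[OF assms(2)] by (cases "h y") auto
  have yr: "(y, r) \<in> epi h" using r by (simp add: epi_def)
  note iff = T_cone_iff[OF assms r]
  have zero: "0 \<in> T_cone h y l"
    unfolding iff using r by (auto simp: epi_def intro!: exI[of _ 1])
  have scale: "s *\<^sub>R w \<in> T_cone h y l" if w: "w \<in> T_cone h y l" and s: "s > 0" for s w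
    unfolding iff
  proof (intro allI impI)
    fix c assume "l \<bullet> (s *\<^sub>R w) < c"
    then have "l \<bullet> w < c / s" using s by (simp add: field_simps)
    with w obtain t where "t > 0" "(y + t *\<^sub>R w, r + t * (c / s)) \<in> epi h"
      unfolding iff by blast
    then show "\<exists>t>0. (y + t *\<^sub>R s *\<^sub>R w, r + t * c) \<in> epi h"
      using s by (intro exI[of _ "t / s"]) simp
  qed
  have add: "w1 + w2 \<in> T_cone h y l" if w: "w1 \<in> T_cone h y l" "w2 \<in> T_cone h y l" for w1 w2
    unfolding iff
  proof (intro allI impI)
    fix c assume c: "l \<bullet> (w1 + w2) < c"
    define e where "e = (c - l \<bullet> (w1 + w2)) / 2"
    have e: "e > 0" using c by (simp add: e_def)
    have "l \<bullet> w1 < l \<bullet> w1 + e" "l \<bullet> w2 < l \<bullet> w2 + e" using e by auto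
    with w obtain t1 t2 where t: "t1 > 0" "(y + t1 *\<^sub>R w1, r + t1 * (l \<bullet> w1 + e)) \<in> epi h"
      "t2 > 0" "(y + t2 *\<^sub>R w2, r + t2 * (l \<bullet> w2 + e)) \<in> epi h"
      unfolding iff by meson
    define t where "t = min t1 t2"
    have t0: "t > 0" "t \<le> t1" "t \<le> t2" using t by (auto simp: t_def)
    have "(1/2) *\<^sub>R (y + t *\<^sub>R w1, r + t * (l \<bullet> w1 + e))
        + (1/2) *\<^sub>R (y + t *\<^sub>R w2, r + t * (l \<bullet> w2 + e)) \<in> epi h"
      using assms(1) convex_epi_segment[OF assms(1) yr t(2) t0(1,2)]
        convex_epi_segment[OF assms(1) yr t(4) t0(1,3)]
      by (intro convexD) auto
    also have "(1/2) *\<^sub>R (y + t *\<^sub>R w1, r + t * (l \<bullet> w1 + e))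
        + (1/2) *\<^sub>R (y + t *\<^sub>R w2, r + t * (l \<bullet> w2 + e)) =
        (y + (t / 2) *\<^sub>R (w1 + w2), r + (t / 2) * c)"
    proof -
      have "(1/2) *\<^sub>R (y + t *\<^sub>R w1) + (1/2) *\<^sub>R (y + t *\<^sub>R w2)
          = ((1/2) *\<^sub>R y + (1/2) *\<^sub>R y) + (t / 2) *\<^sub>R (w1 + w2)"
        by (simp add: algebra_simps)
      also have "(1/2) *\<^sub>R y + (1/2) *\<^sub>R y = y"
        by (metis scaleR_add_right scaleR_half_double)
      finally show ?thesis by (simp add: e_def inner_add_right field_simps)
    qed
    finally show "\<exists>t>0. (y + t *\<^sub>R (w1 + w2), r + t * c) \<in> epi h"
      using t0 by (intro exI[of _ "t / 2"]) auto
  qed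
  show ?thesis
  proof (rule subspaceI)
    show "0 \<in> S_space h y l" using S_spaceI[OF zero zero] by simp
  next
    fix u v assume "u \<in> S_space h y l" "v \<in> S_space h y l"
    then obtain a b a' b' where "u = a - b" "v = a' - b'" "a \<in> T_cone h y l" "b \<in> T_cone h y l"
      "a' \<in> T_cone h y l" "b' \<in> T_cone h y l"
      by (auto simp: S_space_def)
    then have "u + v = (a + a') - (b + b')" "a + a' \<in> T_cone h y l" "b + b' \<in> T_cone h y l"
      using add by auto
    then show "u + v \<in> S_space h y l" by (auto simp: S_space_def)
  next
    fix c :: real and u assume "u \<in> S_space h y l"
    then obtain a b where ab: "u = a - b" "a \<in> T_cone h y l" "b \<in> T_cone h y l"
      by (auto simp: S_space_def)
    consider "c > 0" | "c = 0" | "c < 0" by linarith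
    then show "c *\<^sub>R u \<in> S_space h y l"
    proof cases
      case 1
      then show ?thesis
        using S_spaceI[OF scale[OF ab(2)] scale[OF ab(3)], of c c] ab by (simp add: scaleR_diff_right)
    next
      case 2
      then show ?thesis using S_spaceI[OF zero zero] by simp
    next
      case 3
      then show ?thesis
        using S_spaceI[OF scale[OF ab(3)] scale[OF ab(2)], of "- c" "- c"] ab
        by (simp add: scaleR_diff_right)
    qed
  qed
qed

text \<open>If \<open>l\<close> is a subgradient at both ends of a segment, the function grows with slope exactly \<open>l\<close>
  between them, so the segment points in a critical direction.\<close>

lemma common_subgradient_diff_in_S_space:
  assumes "convex (epi h)" "l \<in> subdiff h y" "l \<in> subdiff h z"
  shows "z - y \<in> S_space h y l"
proof -
  obtain r where r: "h y = ereal r"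
    using subdiff_finite[OF assms(2)] by (cases "h y") auto
  obtain s where s: "h z = ereal s"
    using subdiff_finite[OF assms(3)] by (cases "h z") auto
  note iff = T_cone_iff[OF assms(1,2) r]
  have "s = r + l \<bullet> (z - y)"
    using subdiff_realD[OF assms(2) subdiff_finite[OF assms(3)]]
      subdiff_realD[OF assms(3) subdiff_finite[OF assms(2)]] r s
    by (simp add: inner_diff_right)
  then have "z - y \<in> T_cone h y l"
    unfolding iff using s by (auto simp: epi_def intro!: exI[of _ 1])
  moreover have "0 \<in> T_cone h y l"
    unfolding iff using r by (auto simp: epi_def intro!: exI[of _ 1])
  ultimately show ?thesis using S_spaceI[of "z - y" h y l 0] by simp
qed

section \<open>Orthogonal projection onto a subspace\<close>

lemma orth_proj_properties:
  fixes S :: "'a::euclidean_space set"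
  assumes "subspace S"
  shows "orth_proj S v \<in> S" "s \<in> S \<Longrightarrow> (v - orth_proj S v) \<bullet> s = 0"
proof -
  have span: "span S = S" using assms by (simp add: span_eq_iff)
  obtain p z where pz: "p \<in> S" "\<And>w. w \<in> S \<Longrightarrow> orthogonal z w" "v = p + z"
    using orthogonal_subspace_decomp_exists[of S v] unfolding span by metis
  have pv: "p \<in> S" "\<forall>s\<in>S. orthogonal (v - p) s" using pz by auto
  have uniq: "q = p" if q: "q \<in> S" "\<forall>s\<in>S. orthogonal (v - q) s" for q
  proof -
    have "q - p \<in> S" using q pz assms by (simp add: subspace_diff)
    then have "(v - q) \<bullet> (q - p) = 0" "(v - p) \<bullet> (q - p) = 0"
      using q pv by (auto simp: orthogonal_def)
    then have "(q - p) \<bullet> (q - p) = 0" by (simp add: inner_diff_left)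
    then show ?thesis by simp
  qed
  have "orth_proj S v = p"
    unfolding orth_proj_def by (rule the_equality) (use pv uniq in blast)+
  then show "orth_proj S v \<in> S" "s \<in> S \<Longrightarrow> (v - orth_proj S v) \<bullet> s = 0"
    using pv by (auto simp: orthogonal_def)
qed

lemma orth_proj_unique:
  fixes S :: "'a::euclidean_space set"
  assumes "subspace S" "p \<in> S" "\<And>s. s \<in> S \<Longrightarrow> (v - p) \<bullet> s = 0"
  shows "orth_proj S v = p"
proof -
  have "orth_proj S v - p \<in> S" using orth_proj_properties(1)[OF assms(1)] assms by (simp add: subspace_diff)
  then have "(v - p) \<bullet> (orth_proj S v - p) = 0" "(v - orth_proj S v) \<bullet> (orth_proj S v - p) = 0"
    using assms(3) orth_proj_properties(2)[OF assms(1)] by auto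
  then have "(orth_proj S v - p) \<bullet> (orth_proj S v - p) = 0" by (simp add: inner_diff_left)
  then show ?thesis by simp
qed

lemma linear_orth_residual:
  fixes S :: "'a::euclidean_space set"
  assumes "subspace S"
  shows "linear (\<lambda>v. v - orth_proj S v)"
proof -
  note S = orth_proj_properties[OF assms]
  have "orth_proj S (v + w) = orth_proj S v + orth_proj S w" for v w
    using S(2)[of _ v] S(2)[of _ w]
    by (intro orth_proj_unique assms subspace_add S) (simp add: inner_diff_left inner_add_left)
  moreover have "orth_proj S (c *\<^sub>R v) = c *\<^sub>R orth_proj S v" for c v
    using S(2)[of _ v]
    by (intro orth_proj_unique assms subspace_mul S) (simp add: inner_diff_left)
  ultimately show ?thesis by (intro linearI) (auto simp: algebra_simps)
qed

lemma orth_residual_norm: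
  fixes S :: "'a::euclidean_space set" and v :: 'a
  assumes "subspace S"
  defines "P \<equiv> \<lambda>v. v - orth_proj S v"
  shows "v \<bullet> P v = (norm (P v))\<^sup>2" "norm (P v) \<le> norm v" "P v = 0 \<longleftrightarrow> v \<in> S"
proof -
  note S = orth_proj_properties[OF assms(1)]
  show 1: "v \<bullet> P v = (norm (P v))\<^sup>2"
    using S(2)[OF S(1)[of v], of v]
    by (simp add: P_def power2_norm_eq_inner inner_diff_left inner_diff_right inner_commute)
  have "(norm (P v))\<^sup>2 \<le> norm v * norm (P v)"
    using norm_cauchy_schwarz[of v "P v"] 1 by simp
  then show "norm (P v) \<le> norm v"
    by (cases "P v = 0") (auto simp: power2_eq_square)
  show "P v = 0 \<longleftrightarrow> v \<in> S"
    using S(1)[of v] orth_proj_unique[OF assms(1), of v v] by (auto simp: P_def)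
qed

section \<open>Second-order condition and convexity near the solution\<close>

lemma subspace_parallel_space:
  assumes "x \<in> C"
  shows "subspace (parallel_space C)"
proof -
  have "u - y \<in> (\<lambda>u. u - x) ` (affine hull C)" if "u \<in> affine hull C" "y \<in> C" for u y
  proof -
    have "u + 1 *\<^sub>R (x - y) \<in> affine hull C"
      using that assms by (intro mem_affine_3_minus affine_affine_hull) (auto intro: hull_inc)
    then show ?thesis by (intro image_eqI[of _ _ "u + (x - y)"]) auto
  qed
  then have *: "parallel_space C = (\<lambda>u. u - x) ` (affine hull C)"
    using assms by (auto simp: parallel_space_def)
  show "subspace (parallel_space C)"
    unfolding * using assms by (intro affine_diffs_subspace_subtract) (auto intro: hull_inc)
qed

text \<open>Compactness form of the lemma of Finsler and Debreu: the sets on which the penalized function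
  exceeds \<open>1 / Suc n\<close> with weight \<open>Suc n\<close> are open, increase with \<open>n\<close> and cover the compact set, so one
  of them already contains it. Using the same \<open>n\<close> for bound and weight yields both constants at once.\<close>

lemma penalty_gives_positive_definiteness:
  fixes q p :: "'a::euclidean_space \<Rightarrow> real"
  assumes "compact K" "continuous_on UNIV q" "continuous_on UNIV p" "\<And>v. p v \<ge> 0"
    and "\<And>v. v \<in> K \<Longrightarrow> p v = 0 \<Longrightarrow> q v > 0"
  obtains c \<mu> where "c > 0" "\<mu> > 0" "\<And>v. v \<in> K \<Longrightarrow> \<mu> \<le> q v + c * p v"
proof -
  define W where "W n = {v. 1 / real (Suc n) < q v + real (Suc n) * p v}" for n
  have mono: "W m \<subseteq> W n" if "m \<le> n" for m n
  proof
    fix v assume v: "v \<in> W m"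
    have "1 / real (Suc n) \<le> 1 / real (Suc m)" using that by (simp add: frac_le)
    moreover have "real (Suc m) * p v \<le> real (Suc n) * p v"
      using that assms(4) by (intro mult_right_mono) auto
    ultimately show "v \<in> W n" using v unfolding W_def mem_Collect_eq by linarith
  qed
  have cover: "K \<subseteq> (\<Union>n. W n)"
  proof
    fix v assume v: "v \<in> K"
    show "v \<in> (\<Union>n. W n)"
    proof (cases "p v = 0")
      case True
      then obtain n where "1 / real (Suc n) < q v"
        using assms(5)[OF v] nat_approx_posE by blast
      then show ?thesis using True by (auto simp: W_def)
    next
      case False
      then have pos: "p v > 0" using assms(4)[of v] by linarith
      obtain n :: nat where n: "(1 - q v) / p v < real n" using reals_Archimedean2 by blast
      then have "1 < q v + real n * p v" using pos by (simp add: field_simps)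
      also have "\<dots> \<le> q v + real (Suc n) * p v" using pos by (intro add_left_mono mult_right_mono) auto
      finally have "1 < q v + real (Suc n) * p v" .
      moreover have "1 / real (Suc n) \<le> 1" by simp
      ultimately have "v \<in> W n" unfolding W_def mem_Collect_eq by linarith
      then show ?thesis by blast
    qed
  qed
  have "open (W n)" for n
    unfolding W_def using assms(2,3) by (intro open_Collect_less continuous_intros)
  then obtain N where N: "finite N" "K \<subseteq> (\<Union>n\<in>N. W n)"
    using compactE_image[OF assms(1), of UNIV W] cover by metis
  define n where "n = Max (insert 0 N)"
  have "(\<Union>n\<in>N. W n) \<subseteq> W n"
    using N(1) by (intro UN_least mono) (simp add: n_def)
  with N(2) have "K \<subseteq> W n" by blast
  then show ?thesis
    by (intro that[of "real (Suc n)" "1 / real (Suc n)"]) (auto simp: W_def intro: less_imp_le)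
qed

text \<open>On the unit sphere of \<open>V\<close> the penalized Hessian at \<open>xb\<close> has a positive lower bound \<open>\<mu>\<close>. A Hessian
  that differs from it by at most \<open>\<mu>\<close> in operator norm is still nonnegative there, and homogeneity of
  degree two extends this to all of \<open>V\<close>.\<close>

lemma penalized_hessian_nonneg_near:
  fixes H :: "real^'n \<Rightarrow> real^'n^'n" and p :: "real^'n \<Rightarrow> real"
  assumes V: "subspace V" and H: "isCont H xb"
    and p: "continuous_on UNIV p" "\<And>v. p v \<ge> 0" "\<And>s v. p (s *\<^sub>R v) = s\<^sup>2 * p v"
    and pd: "\<And>v. v \<in> V \<Longrightarrow> v \<noteq> 0 \<Longrightarrow> p v = 0 \<Longrightarrow> v \<bullet> (H xb *v v) > 0"
  obtains c \<delta> where "c > 0" "\<delta> > 0"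
    "\<And>x v. dist x xb < \<delta> \<Longrightarrow> v \<in> V \<Longrightarrow> 0 \<le> v \<bullet> (H x *v v) + c * p v"
proof -
  have "compact (sphere 0 1 \<inter> V)" using V by (intro compact_Int_closed closed_subspace) auto
  then obtain c \<mu> where c: "c > 0" "\<mu> > 0"
    "\<And>v. v \<in> sphere 0 1 \<inter> V \<Longrightarrow> \<mu> \<le> v \<bullet> (H xb *v v) + c * p v"
  proof (rule penalty_gives_positive_definiteness)
    show "continuous_on UNIV (\<lambda>v. v \<bullet> (H xb *v v))"
      by (intro continuous_intros linear_continuous_on matrix_vector_mul_bounded_linear)
    show "0 < v \<bullet> (H xb *v v)" if "v \<in> sphere 0 1 \<inter> V" "p v = 0" for v
      using that by (intro pd) auto
  qed (use p in auto)
  have "((\<lambda>x. \<Sum>i\<in>UNIV. \<Sum>j\<in>UNIV. \<bar>(H x - H xb) $ i $ j\<bar>) \<longlongrightarrow>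
      (\<Sum>i\<in>UNIV. \<Sum>j\<in>UNIV. \<bar>(H xb - H xb) $ i $ j\<bar>)) (at xb)"
    using H unfolding isCont_def by (intro tendsto_intros)
  then have "((\<lambda>x. \<Sum>i\<in>UNIV. \<Sum>j\<in>UNIV. \<bar>(H x - H xb) $ i $ j\<bar>) \<longlongrightarrow> 0) (at xb)"
    by simp
  then obtain \<delta> where d: "\<delta> > 0" "\<And>x. x \<noteq> xb \<Longrightarrow> dist x xb < \<delta> \<Longrightarrow>
      (\<Sum>i\<in>UNIV. \<Sum>j\<in>UNIV. \<bar>(H x - H xb) $ i $ j\<bar>) < \<mu>"
    using c(2) unfolding tendsto_iff eventually_at by (fastforce simp: dist_real_def)
  show ?thesis
  proof (rule that[OF c(1) d(1)])
    fix x v assume x: "dist x xb < \<delta>" and v: "v \<in> V"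
    have small: "(\<Sum>i\<in>UNIV. \<Sum>j\<in>UNIV. \<bar>(H x - H xb) $ i $ j\<bar>) \<le> \<mu>"
      using d(2)[of x] x c(2) by (cases "x = xb") (auto intro: less_imp_le)
    have unit: "0 \<le> u \<bullet> (H x *v u) + c * p u" if u: "u \<in> sphere 0 1 \<inter> V" for u
    proof -
      have "norm ((H x - H xb) *v u) \<le> onorm ((*v) (H x - H xb)) * norm u"
        by (intro onorm matrix_vector_mul_bounded_linear)
      also have "\<dots> \<le> \<mu>"
        using onorm_le_matrix_component_sum[of "H x - H xb"] small u by auto
      finally have "norm ((H x - H xb) *v u) \<le> \<mu>" .
      moreover have "\<bar>u \<bullet> ((H x - H xb) *v u)\<bar> \<le> norm u * norm ((H x - H xb) *v u)"
        by (rule Cauchy_Schwarz_ineq2)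
      ultimately have "u \<bullet> ((H x - H xb) *v u) \<ge> - \<mu>" using u by auto
      then show ?thesis
        using c(3)[OF u] by (simp add: matrix_vector_mult_diff_rdistrib inner_diff_right)
    qed
    show "0 \<le> v \<bullet> (H x *v v) + c * p v"
    proof (cases "v = 0")
      case True
      then show ?thesis using p(2)[of 0] c(1) by simp
    next
      case False
      define u where "u = v /\<^sub>R norm v"
      have u: "u \<in> sphere 0 1 \<inter> V" "v = norm v *\<^sub>R u"
        using False v V by (auto simp: u_def subspace_mul)
      have "v \<bullet> (H x *v v) + c * p v = (norm v)\<^sup>2 * (u \<bullet> (H x *v u) + c * p u)"
        by (subst (1 2 3) u(2))
          (simp add: p(3) matrix_vector_mult_scaleR power2_eq_square algebra_simps)
      then show ?thesis using unit[OF u(1)] by simp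
    qed
  qed
qed

text \<open>Along the segment, adding \<open>a / 2 * s\<^sup>2\<close> makes the function convex. The tangent at \<open>s = 1\<close> then lies
  below the value at \<open>s = 0\<close>, and the slope \<open>a\<close> of the added term at \<open>1\<close> exceeds its value \<open>a / 2\<close> by the
  error term of the claim.\<close>

lemma local_gradient_inequality:
  fixes f :: "'a::real_inner \<Rightarrow> real"
  assumes f: "\<And>x. GDERIV f x :> gradf x"
    and f2: "\<And>x. x \<in> closed_segment xb x1 \<Longrightarrow> (gradf has_derivative H x) (at x)"
    and pos: "\<And>x. x \<in> closed_segment xb x1 \<Longrightarrow> 0 \<le> (x1 - xb) \<bullet> H x (x1 - xb) + a"
  shows "f x1 - f xb \<le> gradf x1 \<bullet> (x1 - xb) + a / 2"
proof -
  define d where "d = x1 - xb"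
  define \<psi> where "\<psi> = (\<lambda>s. f (xb + s *\<^sub>R d) + a / 2 * s\<^sup>2)"
  define \<psi>' where "\<psi>' = (\<lambda>s. gradf (xb + s *\<^sub>R d) \<bullet> d + a * s)"
  define \<psi>'' where "\<psi>'' = (\<lambda>s. d \<bullet> H (xb + s *\<^sub>R d) d + a)"
  have seg: "xb + s *\<^sub>R d \<in> closed_segment xb x1" if "s \<in> {0..1}" for s
    using that by (auto simp: in_segment d_def algebra_simps intro!: exI[of _ s])
  have line: "((\<lambda>s. xb + s *\<^sub>R d) has_derivative (\<lambda>t. t *\<^sub>R d)) (at s)" for s :: real
    by (auto intro!: derivative_eq_intros)
  have "\<psi>' 1 * (0 - 1) \<le> \<psi> 0 - \<psi> 1"
  proof (rule f''_imp_f'[where C = "{0..1}" and f'' = \<psi>''])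
    fix s :: real assume s: "s \<in> {0..1}"
    have "((\<lambda>s. f (xb + s *\<^sub>R d)) has_derivative (\<lambda>t. (t *\<^sub>R d) \<bullet> gradf (xb + s *\<^sub>R d))) (at s)"
      using has_derivative_compose[OF line f[unfolded gderiv_def]] .
    then have "((\<lambda>s. f (xb + s *\<^sub>R d)) has_real_derivative gradf (xb + s *\<^sub>R d) \<bullet> d) (at s)"
      by (simp add: has_field_derivative_def inner_commute mult_commute_abs)
    then show "(\<psi> has_real_derivative \<psi>' s) (at s)"
      unfolding \<psi>_def \<psi>'_def by (auto intro!: derivative_eq_intros)
    have lin: "H (xb + s *\<^sub>R d) (t *\<^sub>R d) = t *\<^sub>R H (xb + s *\<^sub>R d) d" for t
      using f2[OF seg[OF s]] has_derivative_linear linear_scale by blast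
    have "((\<lambda>s. gradf (xb + s *\<^sub>R d) \<bullet> d) has_derivative (\<lambda>t. H (xb + s *\<^sub>R d) (t *\<^sub>R d) \<bullet> d)) (at s)"
      using has_derivative_compose[OF line f2[OF seg[OF s]]] by (rule has_derivative_inner_left)
    then have "((\<lambda>s. gradf (xb + s *\<^sub>R d) \<bullet> d) has_real_derivative d \<bullet> H (xb + s *\<^sub>R d) d) (at s)"
      by (simp add: lin has_field_derivative_def inner_commute mult_commute_abs)
    then show "(\<psi>' has_real_derivative \<psi>'' s) (at s)"
      unfolding \<psi>'_def \<psi>''_def by (auto intro!: derivative_eq_intros)
    show "0 \<le> \<psi>'' s" using pos[OF seg[OF s]] by (simp add: \<psi>''_def d_def)
  qed auto
  then show ?thesis by (simp add: \<psi>_def \<psi>'_def d_def)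
qed

section \<open>Optimality conditions of the two subproblems\<close>

lemma first_order_variational_inequality:
  fixes F :: "'a::real_inner \<Rightarrow> real"
  assumes "is_arg_min F (\<lambda>x. x \<in> C) x" "convex C" "z \<in> C" "GDERIV F x :> G"
  shows "G \<bullet> (z - x) \<ge> 0"
proof (rule ccontr)
  assume neg: "\<not> G \<bullet> (z - x) \<ge> 0"
  have xC: "x \<in> C" and min: "\<And>u. u \<in> C \<Longrightarrow> F x \<le> F u"
    using assms(1) by (auto simp: is_arg_min_def not_less)
  have line: "((\<lambda>s. x + s *\<^sub>R (z - x)) has_derivative (\<lambda>t. t *\<^sub>R (z - x))) (at 0)"
    by (auto intro!: derivative_eq_intros)
  have "((\<lambda>s. F (x + s *\<^sub>R (z - x))) has_derivative (\<lambda>t. (t *\<^sub>R (z - x)) \<bullet> G)) (at 0)"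
    by (rule has_derivative_compose[OF line]) (use assms(4) in \<open>simp add: gderiv_def\<close>)
  then have "((\<lambda>s. F (x + s *\<^sub>R (z - x))) has_real_derivative G \<bullet> (z - x)) (at 0)"
    by (simp add: has_field_derivative_def inner_commute mult_commute_abs)
  from DERIV_neg_dec_right[OF this] neg obtain e where e: "e > 0"
    "\<And>h. h > 0 \<Longrightarrow> h < e \<Longrightarrow> F (x + h *\<^sub>R (z - x)) < F x" by auto
  define h where "h = min 1 (e / 2)"
  have h: "0 < h" "h < e" "h \<le> 1" using e(1) by (auto simp: h_def)
  have "(1 - h) *\<^sub>R x + h *\<^sub>R z \<in> C" using h xC assms by (intro convexD) auto
  then have "x + h *\<^sub>R (z - x) \<in> C" by (simp add: algebra_simps)
  with min e(2)[OF h(1,2)] show False by fastforce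
qed

lemma arg_min_is_arg_min:
  "is_arg_min F Q x \<Longrightarrow> is_arg_min F Q (arg_min F Q)"
  unfolding arg_min_def by (rule someI)

text \<open>The subgradient \<open>l\<close> makes \<open>h - l\<close> bounded below, so the proximal objective is coercive. Minimizing over
  the closed epigraph, where the objective becomes a continuous real function \<open>\<Psi>\<close>, replaces lower
  semicontinuity by attainment on a compact set.\<close>

lemma proximal_minimizer_exists:
  fixes h :: "'a::euclidean_space \<Rightarrow> ereal"
  assumes "closed (epi h)" "\<And>y. h y \<noteq> - \<infinity>" "l \<in> subdiff h y0" "\<beta> > 0"
  shows "\<exists>y. is_arg_min (\<lambda>y. h y + ereal (l \<bullet> (- y)) + ereal (\<beta> / 2 * (norm (z - y))\<^sup>2)) (\<lambda>_. True) y"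
proof -
  define \<Psi> where "\<Psi> = (\<lambda>u::'a \<times> real. snd u - l \<bullet> fst u + \<beta> / 2 * (norm (z - fst u))\<^sup>2)"
  have cont: "continuous_on S \<Psi>" for S
    unfolding \<Psi>_def by (intro continuous_intros)
  obtain r0 where r0: "h y0 = ereal r0"
    using subdiff_finite[OF assms(3)] by (cases "h y0") auto
  define M where "M = \<Psi> (y0, r0)"
  \<comment> \<open>\<open>\<rho>\<close> and \<open>T\<close> bound the two components of the sublevel set through \<open>(y0, r0)\<close>\<close>
  define \<rho> where "\<rho> = sqrt (2 * (M - r0 + l \<bullet> y0) / \<beta>)"
  define R where "R = norm z + \<rho>"
  define T where "T = \<bar>r0\<bar> + \<bar>M\<bar> + norm l * R + norm l * norm y0"
  define K where "K = (epi h \<inter> {u. \<Psi> u \<le> M}) \<inter> (cball z \<rho> \<times> {- T..T})"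
  have inK: "u \<in> K" if u: "u \<in> epi h" "\<Psi> u \<le> M" for u
  proof -
    obtain y t where yt: "u = (y, t)" by force
    have low: "r0 + l \<bullet> (y - y0) \<le> t"
      using subdiff_epiD[OF assms(3), of y t] u yt r0 by simp
    have up: "t - l \<bullet> y + \<beta> / 2 * (norm (z - y))\<^sup>2 \<le> M"
      using u(2) by (simp add: \<Psi>_def yt)
    have "\<beta> / 2 * (norm (z - y))\<^sup>2 \<le> M - r0 + l \<bullet> y0"
      using low up by (simp add: inner_diff_right)
    then have "(norm (z - y))\<^sup>2 \<le> 2 * (M - r0 + l \<bullet> y0) / \<beta>"
      using assms(4) by (simp add: field_simps)
    then have near: "norm (z - y) \<le> \<rho>" unfolding \<rho>_def by (rule real_le_rsqrt)
    have "norm y \<le> R" using near norm_triangle_ineq2[of y z] by (simp add: R_def norm_minus_commute)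
    then have "norm l * norm y \<le> norm l * R" by (simp add: mult_left_mono)
    then have ly: "\<bar>l \<bullet> y\<bar> \<le> norm l * R" using Cauchy_Schwarz_ineq2[of l y] by simp
    have "\<bar>l \<bullet> y0\<bar> \<le> norm l * norm y0" by (rule Cauchy_Schwarz_ineq2)
    moreover have "t \<le> M + l \<bullet> y" using up assms(4) zero_le_power2[of "norm (z - y)"]
      by (smt (verit) divide_nonneg_nonneg mult_nonneg_nonneg)
    moreover have "0 \<le> norm l * norm y0" by simp
    ultimately have "- T \<le> t" "t \<le> T"
      using low ly unfolding T_def inner_diff_right by linarith+
    then show ?thesis using u near by (simp add: K_def yt dist_norm)
  qed
  have "compact K"
    unfolding K_def using assms(1) cont
    by (intro closed_Int_compact closed_Int compact_Times closed_Collect_le continuous_intros) auto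
  moreover have "K \<noteq> {}"
    using inK[of "(y0, r0)"] r0 by (auto simp: M_def epi_def)
  ultimately obtain u where u: "u \<in> K" "\<And>v. v \<in> K \<Longrightarrow> \<Psi> u \<le> \<Psi> v"
    using continuous_attains_inf[OF _ _ cont] by metis
  have uepi: "u \<in> epi h" "\<Psi> u \<le> M" using u(1) by (auto simp: K_def)
  have min: "\<Psi> u \<le> \<Psi> v" if "v \<in> epi h" for v
    using inK[OF that] u(2)[of v] uepi(2) by linarith
  let ?\<phi> = "\<lambda>y. h y + ereal (l \<bullet> (- y)) + ereal (\<beta> / 2 * (norm (z - y))\<^sup>2)"
  have "?\<phi> (fst u) \<le> ?\<phi> y" for y
  proof (cases "h y")
    case (real s)
    have "h (fst u) \<le> ereal (snd u)" using uepi(1) by (auto simp: epi_def)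
    then have "?\<phi> (fst u) \<le> ereal (\<Psi> u)"
      by (cases "h (fst u)") (auto simp: \<Psi>_def)
    also have "\<Psi> u \<le> \<Psi> (y, s)" using real by (intro min) (simp add: epi_def)
    also have "ereal (\<Psi> (y, s)) = ?\<phi> y" by (simp add: real \<Psi>_def)
    finally show ?thesis by simp
  qed (use assms(2) in auto)
  then show ?thesis by (auto simp: is_arg_min_def not_less)
qed

text \<open>A minimizer of the extended-real objective is a minimizer of a smooth function over the convex
  epigraph. The variational inequality for that problem says that \<open>(- (l + \<beta> (z - y1)), 1)\<close> supports
  the epigraph at \<open>(y1, h y1)\<close>, which is the claim.\<close>

lemma proximal_step_subgradient:
  fixes h :: "'a::euclidean_space \<Rightarrow> ereal"
  assumes "convex (epi h)" "\<And>y. h y \<noteq> - \<infinity>" "\<bar>h y0\<bar> \<noteq> \<infinity>"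
    and min: "is_arg_min (\<lambda>y. h y + ereal (l \<bullet> (- y)) + ereal (\<beta> / 2 * (norm (z - y))\<^sup>2)) (\<lambda>_. True) y1"
  shows "l + \<beta> *\<^sub>R (z - y1) \<in> subdiff h y1"
proof -
  let ?\<phi> = "\<lambda>y. h y + ereal (l \<bullet> (- y)) + ereal (\<beta> / 2 * (norm (z - y))\<^sup>2)"
  define \<Psi> where "\<Psi> = (\<lambda>u::'a \<times> real. snd u - l \<bullet> fst u + \<beta> / 2 * ((z - fst u) \<bullet> (z - fst u)))"
  have le: "?\<phi> y1 \<le> ?\<phi> y" for y using min by (auto simp: is_arg_min_def not_less)
  have "h y1 \<noteq> \<infinity>" using le[of y0] assms(3) by (cases "h y0") auto
  then obtain r1 where r1: "h y1 = ereal r1" using assms(2)[of y1] by (cases "h y1") auto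
  have "is_arg_min \<Psi> (\<lambda>u. u \<in> epi h) (y1, r1)"
  proof -
    have "\<Psi> (y1, r1) \<le> \<Psi> u" if "u \<in> epi h" for u
    proof -
      have "?\<phi> y1 = ereal (\<Psi> (y1, r1))" by (simp add: r1 \<Psi>_def power2_norm_eq_inner)
      moreover have "?\<phi> (fst u) \<le> ereal (\<Psi> u)"
        using that by (cases "h (fst u)") (auto simp: \<Psi>_def power2_norm_eq_inner epi_def)
      ultimately show ?thesis using le[of "fst u"] by (metis ereal_less_eq(3) order_trans)
    qed
    then show ?thesis by (auto simp: is_arg_min_def r1 epi_def not_less)
  qed
  moreover have "GDERIV \<Psi> (y1, r1) :> (- (l + \<beta> *\<^sub>R (z - y1)), 1)"
    unfolding gderiv_def \<Psi>_def
    by (auto intro!: derivative_eq_intros simp: fun_eq_iff inner_add_left inner_add_right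
        inner_diff_left inner_diff_right inner_commute algebra_simps)
  ultimately have "(- (l + \<beta> *\<^sub>R (z - y1)), 1) \<bullet> ((u, t) - (y1, r1)) \<ge> 0" if "(u, t) \<in> epi h" for u t
    using first_order_variational_inequality[OF _ assms(1) that] by blast
  then have "r1 + (l + \<beta> *\<^sub>R (z - y1)) \<bullet> (u - y1) \<le> t" if "(u, t) \<in> epi h" for u t
    using that unfolding diff_Pair inner_Pair inner_minus_left inner_real_def by fastforce
  then show ?thesis
    by (auto simp: subdiff_iff_epi r1)
qed

text \<open>The multiplier and proximal updates are complementary parts of one vector:
  \<open>(lk - lb) + \<beta> (z - yb) = (l1 - lb) + \<beta> (y1 - yb)\<close>. By monotonicity of the subdifferential the two
  parts enclose an angle of at most ninety degrees, so neither is longer than the whole. This keeps the new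
  multiplier close to \<open>lb\<close>.\<close>

lemma nonexpansive_multiplier_update:
  fixes y1 :: "'a::real_inner"
  assumes "(l1 - lb) \<bullet> (y1 - yb) \<ge> 0" "l1 = lk + \<beta> *\<^sub>R (z - y1)" "\<beta> > 0"
  shows "norm (l1 - lb) \<le> norm (lk - lb) + \<beta> * norm (z - yb)"
proof -
  define u where "u = (lk - lb) + \<beta> *\<^sub>R (z - yb)"
  have u: "u = (l1 - lb) + \<beta> *\<^sub>R (y1 - yb)" by (simp add: u_def assms(2) algebra_simps)
  have "(norm u)\<^sup>2 = (norm (l1 - lb))\<^sup>2 + 2 * \<beta> * ((l1 - lb) \<bullet> (y1 - yb)) + \<beta>\<^sup>2 * (norm (y1 - yb))\<^sup>2"
    unfolding u power2_norm_eq_inner inner_add_left inner_add_right inner_scaleR_left inner_scaleR_right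
    by (simp add: inner_commute power2_eq_square algebra_simps)
  then have "(norm (l1 - lb))\<^sup>2 \<le> (norm u)\<^sup>2" using assms by simp
  then have "norm (l1 - lb) \<le> norm u" by (rule power2_le_imp_le) simp
  also have "\<dots> \<le> norm (lk - lb) + norm (\<beta> *\<^sub>R (z - yb))" unfolding u_def by (rule norm_triangle_ineq)
  finally show ?thesis using assms(3) by simp
qed

section \<open>Bounds for the reduced augmented Lagrangian\<close>

lemma moreau_quadratic_identity:
  fixes y :: "'a::real_inner"
  assumes "\<beta> > 0"
  shows "\<beta> / 2 * (norm (y - (z + l /\<^sub>R \<beta>)))\<^sup>2
    = l \<bullet> (z - y) + \<beta> / 2 * (norm (z - y))\<^sup>2 + 1 / (2 * \<beta>) * (norm l)\<^sup>2"
proof -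
  have "y - (z + l /\<^sub>R \<beta>) = - ((z - y) + (1 / \<beta>) *\<^sub>R l)" by (simp add: divide_inverse)
  then have "(norm (y - (z + l /\<^sub>R \<beta>)))\<^sup>2 = (norm ((z - y) + (1 / \<beta>) *\<^sub>R l))\<^sup>2"
    by (metis norm_minus_cancel)
  also have "\<dots> = (norm (z - y))\<^sup>2 + 2 / \<beta> * (l \<bullet> (z - y)) + (norm l)\<^sup>2 / \<beta>\<^sup>2"
    unfolding power2_norm_eq_inner
    by (simp only: inner_add_left inner_add_right inner_scaleR_left inner_scaleR_right)
      (simp add: inner_commute power2_eq_square add_divide_distrib ring_distribs)
  finally show ?thesis using assms by (simp add: power2_eq_square field_simps)
qed

text \<open>Every point \<open>y\<close> may be inserted into the infimum that defines the Moreau envelope.\<close>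

lemma reduced_aug_lagrangian_le:
  assumes "\<beta> > 0" "x \<in> C" "g y = ereal r"
  shows "reduced_aug_lagrangian f g A C \<beta> x l
    \<le> ereal (f x + r + l \<bullet> (A *v x - y) + \<beta> / 2 * (norm (A *v x - y))\<^sup>2)"
proof -
  have "moreau_env \<beta> g (A *v x + l /\<^sub>R \<beta>)
      \<le> g y + ereal (\<beta> / 2 * (norm (y - (A *v x + l /\<^sub>R \<beta>)))\<^sup>2)"
    unfolding moreau_env_def by (rule INF_lower) simp
  also have "\<dots> = ereal (r + (l \<bullet> (A *v x - y) + \<beta> / 2 * (norm (A *v x - y))\<^sup>2 + 1 / (2 * \<beta>) * (norm l)\<^sup>2))"
    by (simp only: moreau_quadratic_identity[OF assms(1)] assms(3) plus_ereal.simps)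
  finally show ?thesis
    using assms(2) unfolding reduced_aug_lagrangian_def indicator_fn_def
    by (cases "moreau_env \<beta> g (A *v x + l /\<^sub>R \<beta>)") auto
qed

text \<open>When \<open>l\<close> is a subgradient at \<open>A x\<close>, the linear term of the completed square is absorbed by the
  subgradient inequality, so the infimum is not below the value at \<open>y = A x\<close>.\<close>

lemma reduced_aug_lagrangian_ge:
  assumes "\<beta> > 0" "x \<in> C" "l \<in> subdiff g (A *v x)" "g (A *v x) = ereal r"
  shows "ereal (f x + r) \<le> reduced_aug_lagrangian f g A C \<beta> x l"
proof -
  have "ereal (r + 1 / (2 * \<beta>) * (norm l)\<^sup>2) \<le> moreau_env \<beta> g (A *v x + l /\<^sub>R \<beta>)"
    unfolding moreau_env_def
  proof (rule INF_greatest)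
    fix y
    have "ereal (r + l \<bullet> (y - A *v x)) \<le> g y"
      using assms(3,4) by (auto simp: subdiff_def)
    moreover have "0 \<le> \<beta> / 2 * (norm (A *v x - y))\<^sup>2" using assms(1) by simp
    ultimately show "ereal (r + 1 / (2 * \<beta>) * (norm l)\<^sup>2)
        \<le> g y + ereal (\<beta> / 2 * (norm (y - (A *v x + l /\<^sub>R \<beta>)))\<^sup>2)"
      unfolding moreau_quadratic_identity[OF assms(1)]
      by (cases "g y") (auto simp: inner_diff_right)
  qed
  then show ?thesis
    using assms(2) unfolding reduced_aug_lagrangian_def indicator_fn_def
    by (cases "moreau_env \<beta> g (A *v x + l /\<^sub>R \<beta>)") auto
qed

lemma augmented_lagrangian_gradient:
  fixes A :: "real^'n^'m"
  assumes "GDERIV f x :> gx"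
  shows "GDERIV (\<lambda>x. f x + l \<bullet> (A *v x) + \<beta> / 2 * (norm (A *v x - y))\<^sup>2) x
    :> gx + transpose A *v (l + \<beta> *\<^sub>R (A *v x - y))"
proof -
  have adj: "h \<bullet> (transpose A *v w) = (A *v h) \<bullet> w" for h w
    by (metis dot_lmul_matrix inner_commute transpose_matrix_vector)
  have A: "((*v) A has_derivative (*v) A) (at x)"
    by (intro bounded_linear_imp_has_derivative matrix_vector_mul_bounded_linear)
  have f: "(f has_derivative (\<lambda>h. h \<bullet> gx)) (at x)" using assms by (simp add: gderiv_def)
  show ?thesis
    unfolding gderiv_def power2_norm_eq_inner
    by (rule has_derivative_eq_rhs, (rule derivative_intros f A)+)
      (auto simp: fun_eq_iff adj inner_add_left inner_add_right
        inner_diff_left inner_diff_right inner_commute algebra_simps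
        simp del: transpose_matrix_vector)
qed

section \<open>One step of the alternating direction iteration\<close>

text \<open>The algebra of one step, with \<open>r = z - y1\<close> and \<open>l1 - lk = \<beta> r\<close>. The cross term
  \<open>\<beta> (y1 - yk) \<bullet> r\<close> is nonnegative by monotonicity; the three-point identity turns the other two inner
  products into differences of squared distances. What is left over is \<open>\<beta>0 / 2\<close> times the squared
  norm of \<open>r\<close> and \<open>\<theta> \<beta> / 2 * q\<close>. The bound on \<open>q\<close> turns this into a multiple of the squared norm of
  \<open>l1 - lk\<close>.\<close>

lemma admm_descent_inequality:
  fixes z y1 yk yb l1 lk ls :: "'a::real_inner"
  assumes "\<beta> > 0" "\<theta> > 0"
    and f: "F1 - F0 \<le> - ((l1 + \<beta> *\<^sub>R (y1 - yk)) \<bullet> (z - yb)) + \<beta>0 / 2 * q"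
    and g: "G1 - G0 \<le> l1 \<bullet> (y1 - yb)"
    and mono: "(l1 - lk) \<bullet> (y1 - yk) \<ge> 0"
    and l1: "l1 = lk + \<beta> *\<^sub>R (z - y1)"
    and q: "q \<le> (norm (z - y1))\<^sup>2"
  shows "(F1 + G1 + ls \<bullet> (z - y1) + \<beta>0 / 2 * (norm (z - y1))\<^sup>2) - (F0 + G0) + (\<theta> * \<beta> - \<beta>0) / 2 * q
    \<le> \<beta> / 2 * ((norm (yk - yb))\<^sup>2 - (norm (y1 - yb))\<^sup>2)
      + 1 / (2 * \<beta>) * ((norm (lk - ls))\<^sup>2 - (norm (l1 - ls))\<^sup>2)
      - \<beta> / 2 * (norm (y1 - yk))\<^sup>2
      - ((1 - \<theta>) * \<beta> - \<beta>0) / (2 * \<beta>\<^sup>2) * (norm (l1 - lk))\<^sup>2"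
proof -
  define r where "r = z - y1"
  have lr: "l1 - lk = \<beta> *\<^sub>R r" by (simp add: l1 r_def)
  have three_point: "(norm (a - b))\<^sup>2 = (norm (c - b))\<^sup>2 - 2 * ((c - b) \<bullet> (c - a)) + (norm (c - a))\<^sup>2"
    for a b c :: 'a
    by (simp add: power2_norm_eq_inner inner_diff_left inner_diff_right inner_commute)
  have nl: "(norm (l1 - lk))\<^sup>2 = \<beta>\<^sup>2 * (norm r)\<^sup>2"
    by (simp add: lr power_mult_distrib)
  have ls_part: "1 / (2 * \<beta>) * ((norm (lk - ls))\<^sup>2 - (norm (l1 - ls))\<^sup>2)
      = - ((l1 - ls) \<bullet> r) + \<beta> / 2 * (norm r)\<^sup>2"
    unfolding three_point[of lk ls l1] nl lr using assms(1)
    by (simp add: power2_eq_square field_simps)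
  have y_part: "\<beta> / 2 * ((norm (yk - yb))\<^sup>2 - (norm (y1 - yb))\<^sup>2) - \<beta> / 2 * (norm (y1 - yk))\<^sup>2
      = - \<beta> * ((y1 - yk) \<bullet> (y1 - yb))"
    unfolding three_point[of yk yb y1] by (simp add: inner_commute algebra_simps)
  have last: "((1 - \<theta>) * \<beta> - \<beta>0) / (2 * \<beta>\<^sup>2) * (norm (l1 - lk))\<^sup>2 = ((1 - \<theta>) * \<beta> - \<beta>0) / 2 * (norm r)\<^sup>2"
    unfolding nl using assms(1) by (simp add: field_simps)
  have cross: "0 \<le> \<beta> * ((y1 - yk) \<bullet> r)" using mono by (simp add: lr inner_commute)
  have "z - yb = r + (y1 - yb)" by (simp add: r_def)
  then have f': "F1 - F0 \<le> - (l1 \<bullet> r) - l1 \<bullet> (y1 - yb) - \<beta> * ((y1 - yk) \<bullet> r)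
      - \<beta> * ((y1 - yk) \<bullet> (y1 - yb)) + \<beta>0 / 2 * q"
    using f by (simp add: inner_add_left inner_add_right algebra_simps)
  have q': "\<theta> * \<beta> / 2 * q \<le> \<theta> * \<beta> / 2 * (norm r)\<^sup>2"
    using q assms(1,2) by (intro mult_left_mono) (auto simp: r_def)
  have "(F1 + G1 + ls \<bullet> r + \<beta>0 / 2 * (norm r)\<^sup>2) - (F0 + G0) + (\<theta> * \<beta> - \<beta>0) / 2 * q
      \<le> - ((l1 - ls) \<bullet> r) - \<beta> * ((y1 - yk) \<bullet> (y1 - yb)) + \<theta> * \<beta> / 2 * q + \<beta>0 / 2 * (norm r)\<^sup>2"
    using f' g cross by (simp add: inner_diff_left algebra_simps diff_divide_distrib add_divide_distrib)
  also have "\<dots> \<le> - \<beta> * ((y1 - yk) \<bullet> (y1 - yb)) + (- ((l1 - ls) \<bullet> r) + \<beta> / 2 * (norm r)\<^sup>2)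
      - ((1 - \<theta>) * \<beta> - \<beta>0) / 2 * (norm r)\<^sup>2"
    using q' by (simp add: field_simps)
  finally show ?thesis
    unfolding last ls_part using y_part by (simp add: r_def)
qed

text \<open>The radius of the multiplier neighbourhood is half of the stability radius \<open>\<epsilon>\<close> of the
  subgradients of \<open>g\<close>; the other half is left for the change of the multiplier caused by
  \<open>\<beta> A (x1 - xbar)\<close>, which dictates a radius of order \<open>\<epsilon> / \<beta>\<close> for the primal neighbourhood.\<close>

theorem proposition8:
  fixes A :: "real^'n^'m"
    and C :: "(real^'n) set"
    and f :: "real^'n \<Rightarrow> real"
    and gradf :: "real^'n \<Rightarrow> real^'n"
    and hessf :: "real^'n \<Rightarrow> real^'n^'n"
    and g :: "real^'m \<Rightarrow> ereal"
    and xbar :: "real^'n" and lbar :: "real^'m"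
    and U :: "(real^'n) set"
  assumes "C \<noteq> {}" "closed C" "convex C"
    and "\<And>x. GDERIV f x :> gradf x" "continuous_on UNIV gradf"
    and "\<And>y. g y \<noteq> - \<infinity>" "polyhedral_convex g"
    and "edom g \<inter> ((*v) A) ` rel_interior C \<noteq> {}"
    and "\<exists>v \<in> subdiff (indicator_fn C) xbar. 0 = v + gradf xbar + transpose A *v lbar"
    and "lbar \<in> subdiff g (A *v xbar)"
    and "convex_nbhd xbar U"
    and "\<And>x. x \<in> U \<Longrightarrow> (gradf has_derivative (\<lambda>v. hessf x *v v)) (at x)"
    and "continuous_on U hessf"
    and "pos_def_rel (hessf xbar) (parallel_space C \<inter> S_space_pre g A xbar lbar)"
  shows "\<exists>\<beta>0>0. \<forall>\<beta>\<ge>\<beta>0. \<exists>X \<Lambda>. convex_nbhd (xbar, lbar) (X \<times> \<Lambda>) \<and>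
    (\<forall>yk lk x1 y1 l1.
      yk \<in> edom g \<and> lk \<in> \<Lambda> \<inter> subdiff g yk \<and>
      is_arg_min (\<lambda>x. f x + lk \<bullet> (A *v x) + \<beta> / 2 * (norm (A *v x - yk))\<^sup>2) (\<lambda>x. x \<in> C) x1 \<and>
      x1 \<in> X \<and>
      y1 = arg_min (\<lambda>y. g y + ereal (lk \<bullet> (- y)) + ereal (\<beta> / 2 * (norm (A *v x1 - y))\<^sup>2))
             (\<lambda>_. True) \<and>
      l1 = lk + \<beta> *\<^sub>R (A *v x1 - y1) \<longrightarrow>
      (\<forall>ls \<theta>.
        saddle_point (reduced_aug_lagrangian f g A C \<beta>0) X \<Lambda> xbar ls \<and> 0 < \<theta> \<and> \<theta> < 1 \<longrightarrow>
        reduced_aug_lagrangian f g A C \<beta>0 x1 ls - reduced_aug_lagrangian f g A C \<beta>0 xbar ls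
          + ereal ((\<theta> * \<beta> - \<beta>0) / 2 *
              ((x1 - xbar) \<bullet> (transpose A *v P_map g (A *v xbar) lbar (A *v (x1 - xbar)))))
        \<le> ereal (\<beta> / 2 * ((norm (yk - A *v xbar))\<^sup>2 - (norm (y1 - A *v xbar))\<^sup>2)
            + 1 / (2 * \<beta>) * ((norm (lk - ls))\<^sup>2 - (norm (l1 - ls))\<^sup>2)
            - \<beta> / 2 * (norm (y1 - yk))\<^sup>2
            - ((1 - \<theta>) * \<beta> - \<beta>0) / (2 * \<beta>\<^sup>2) * (norm (l1 - lk))\<^sup>2)))"
proof -
  let ?yb = "A *v xbar"
  let ?S = "S_space g ?yb lbar"
  let ?P = "P_map g ?yb lbar"
  have poly: "polyhedron (epi g)" using assms(7) by (simp add: polyhedral_convex_def)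
  have cl: "closed (epi g)" using poly by (rule polyhedron_imp_closed)
  have cvx: "convex (epi g)" using poly by (rule polyhedron_imp_convex)
  have xbC: "xbar \<in> C"
    using assms(9) by (auto simp: subdiff_def indicator_fn_def split: if_splits)
  have lb: "lbar \<in> subdiff g ?yb" by (rule assms(10))
  obtain G0 where G0: "g ?yb = ereal G0"
    using subdiff_finite[OF lb] by (cases "g ?yb") auto
  have subS: "subspace ?S" by (rule subspace_S_space[OF cvx lb])
  have P_eq: "?P v = v - orth_proj ?S v" for v by (simp add: P_map_def)
  have linP: "linear ?P" unfolding P_map_def by (rule linear_orth_residual[OF subS])
  note P = orth_residual_norm[OF subS, folded P_eq]
  define p where "p v = (norm (?P (A *v v)))\<^sup>2" for v
  have xbU: "xbar \<in> interior U" using assms(11) by (simp add: convex_nbhd_def)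
  have "continuous (at xbar within U) hessf"
    using assms(13) xbU interior_subset by (auto simp: continuous_on_eq_continuous_within)
  then have contH: "isCont hessf xbar"
    using xbU by (metis continuous_within at_within_interior)
  obtain \<beta>0 \<delta>1 where b0: "\<beta>0 > 0" and d1: "\<delta>1 > 0"
    and hess: "\<And>x v. dist x xbar < \<delta>1 \<Longrightarrow> v \<in> parallel_space C \<Longrightarrow>
        0 \<le> v \<bullet> (hessf x *v v) + \<beta>0 * p v"
  proof (rule penalized_hessian_nonneg_near[OF subspace_parallel_space[OF xbC] contH, of p])
    show "continuous_on UNIV p"
      unfolding p_def
      by (intro continuous_intros linear_continuous_on linear_conv_bounded_linear[THEN iffD1]
          linear_compose[OF matrix_vector_mul_linear linP, unfolded o_def])
    show "p (s *\<^sub>R v) = s\<^sup>2 * p v" for s v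
      by (simp add: p_def matrix_vector_mult_scaleR linear_scale[OF linP] power_mult_distrib)
    show "0 < v \<bullet> (hessf xbar *v v)" if "v \<in> parallel_space C" "v \<noteq> 0" "p v = 0" for v
      using that assms(14) P(3)[of "A *v v"] by (auto simp: p_def pos_def_rel_def S_space_pre_def)
  qed (auto simp: p_def)
  obtain \<delta>2 where d2: "\<delta>2 > 0" "ball xbar \<delta>2 \<subseteq> U"
    using xbU by (auto simp: mem_interior)
  obtain \<epsilon> where eps: "\<epsilon> > 0" "\<And>y l. l \<in> subdiff g y \<Longrightarrow> dist l lbar < \<epsilon> \<Longrightarrow> lbar \<in> subdiff g y"
    using polyhedral_subgradient_stable[OF assms(7)] by metis
  obtain B where B: "B > 0" "\<And>v. norm (A *v v) \<le> norm v * B"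
    using bounded_linear.pos_bounded[OF matrix_vector_mul_bounded_linear[of A]] by blast
  show ?thesis
  proof (intro exI[of _ \<beta>0] conjI allI impI b0)
    fix \<beta> assume "\<beta>0 \<le> \<beta>"
    then have b: "\<beta> > 0" using b0 by simp
    define \<delta> where "\<delta> = min (min \<delta>1 \<delta>2) (\<epsilon> / (2 * \<beta> * B))"
    have d: "\<delta> > 0" "\<delta> \<le> \<delta>1" "\<delta> \<le> \<delta>2" "\<beta> * (\<delta> * B) \<le> \<epsilon> / 2"
    proof -
      have "\<delta> \<le> \<epsilon> / (2 * \<beta> * B)" by (simp add: \<delta>_def)
      then show "\<beta> * (\<delta> * B) \<le> \<epsilon> / 2" using b B(1) by (simp add: field_simps)
    qed (use d1 d2 eps b B in \<open>auto simp: \<delta>_def\<close>)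
    show "\<exists>X \<Lambda>. convex_nbhd (xbar, lbar) (X \<times> \<Lambda>) \<and>
    (\<forall>yk lk x1 y1 l1.
      yk \<in> edom g \<and> lk \<in> \<Lambda> \<inter> subdiff g yk \<and>
      is_arg_min (\<lambda>x. f x + lk \<bullet> (A *v x) + \<beta> / 2 * (norm (A *v x - yk))\<^sup>2) (\<lambda>x. x \<in> C) x1 \<and>
      x1 \<in> X \<and>
      y1 = arg_min (\<lambda>y. g y + ereal (lk \<bullet> (- y)) + ereal (\<beta> / 2 * (norm (A *v x1 - y))\<^sup>2))
             (\<lambda>_. True) \<and>
      l1 = lk + \<beta> *\<^sub>R (A *v x1 - y1) \<longrightarrow>
      (\<forall>ls \<theta>.
        saddle_point (reduced_aug_lagrangian f g A C \<beta>0) X \<Lambda> xbar ls \<and> 0 < \<theta> \<and> \<theta> < 1 \<longrightarrow>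
        reduced_aug_lagrangian f g A C \<beta>0 x1 ls - reduced_aug_lagrangian f g A C \<beta>0 xbar ls
          + ereal ((\<theta> * \<beta> - \<beta>0) / 2 * ((x1 - xbar) \<bullet> (transpose A *v ?P (A *v (x1 - xbar)))))
        \<le> ereal (\<beta> / 2 * ((norm (yk - ?yb))\<^sup>2 - (norm (y1 - ?yb))\<^sup>2)
            + 1 / (2 * \<beta>) * ((norm (lk - ls))\<^sup>2 - (norm (l1 - ls))\<^sup>2)
            - \<beta> / 2 * (norm (y1 - yk))\<^sup>2
            - ((1 - \<theta>) * \<beta> - \<beta>0) / (2 * \<beta>\<^sup>2) * (norm (l1 - lk))\<^sup>2)))"
    proof (intro exI[of _ "ball xbar \<delta>"] exI[of _ "ball lbar (\<epsilon> / 2)"] conjI allI impI; (elim conjE)?)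
      show "convex_nbhd (xbar, lbar) (ball xbar \<delta> \<times> ball lbar (\<epsilon> / 2))"
        using d(1) eps(1) by (simp add: convex_nbhd_def convex_Times interior_Times)
    next
      fix yk lk x1 y1 l1 ls and \<theta> :: real
      assume lk: "lk \<in> ball lbar (\<epsilon> / 2) \<inter> subdiff g yk"
        and x1: "is_arg_min (\<lambda>x. f x + lk \<bullet> (A *v x) + \<beta> / 2 * (norm (A *v x - yk))\<^sup>2) (\<lambda>x. x \<in> C) x1"
        and x1X: "x1 \<in> ball xbar \<delta>"
        and y1: "y1 = arg_min (\<lambda>y. g y + ereal (lk \<bullet> (- y)) + ereal (\<beta> / 2 * (norm (A *v x1 - y))\<^sup>2))
             (\<lambda>_. True)"
        and l1: "l1 = lk + \<beta> *\<^sub>R (A *v x1 - y1)"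
        and saddle: "saddle_point (reduced_aug_lagrangian f g A C \<beta>0) (ball xbar \<delta>) (ball lbar (\<epsilon> / 2)) xbar ls"
        and th: "0 < \<theta>"
      have x1C: "x1 \<in> C" using x1 by (simp add: is_arg_min_def)
      define dx where "dx = x1 - xbar"
      have Adx: "A *v dx = A *v x1 - ?yb" by (simp add: dx_def matrix_vector_mult_diff_distrib)
      have lksub: "lk \<in> subdiff g yk" using lk by simp
      have l1sub: "l1 \<in> subdiff g y1"
        unfolding l1
      proof (rule proximal_step_subgradient[OF cvx assms(6) subdiff_finite[OF lb]])
        show "is_arg_min (\<lambda>y. g y + ereal (lk \<bullet> (- y)) + ereal (\<beta> / 2 * (norm (A *v x1 - y))\<^sup>2)) (\<lambda>_. True) y1"
          unfolding y1
          by (rule exE[OF proximal_minimizer_exists[OF cl assms(6) lksub b, of "A *v x1"]])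
            (rule arg_min_is_arg_min)
      qed
      \<comment> \<open>the new multiplier stays within the stability radius of \<open>lbar\<close>\<close>
      have "norm (l1 - lbar) \<le> norm (lk - lbar) + \<beta> * norm (A *v dx)"
        unfolding Adx
        by (rule nonexpansive_multiplier_update[OF subdiff_monotone[OF l1sub lb] l1 b])
      also have "\<dots> < \<epsilon> / 2 + \<epsilon> / 2"
      proof (rule add_less_le_mono)
        show "norm (lk - lbar) < \<epsilon> / 2" using lk by (simp add: dist_norm norm_minus_commute)
        have "norm dx \<le> \<delta>" using x1X by (simp add: dx_def dist_norm norm_minus_commute)
        then have "norm (A *v dx) \<le> \<delta> * B"
          using B(2)[of dx] B(1) by (meson mult_right_mono less_imp_le order_trans)
        then have "\<beta> * norm (A *v dx) \<le> \<beta> * (\<delta> * B)" using b by (simp add: mult_left_mono)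
        then show "\<beta> * norm (A *v dx) \<le> \<epsilon> / 2" using d(4) by simp
      qed
      finally have "dist l1 lbar < \<epsilon>" by (simp add: dist_norm)
      then have "lbar \<in> subdiff g y1" by (rule eps(2)[OF l1sub])
      then have "y1 - ?yb \<in> ?S" by (rule common_subgradient_diff_in_S_space[OF cvx lb])
      then have "?P (y1 - ?yb) = 0" by (simp add: P(3))
      \<comment> \<open>the part of \<open>A dx\<close> that is not the residual lies in the kernel of \<open>P\<close>\<close>
      moreover have split: "A *v dx = (A *v x1 - y1) + (y1 - ?yb)" by (simp add: Adx)
      have "?P (A *v dx) = ?P (A *v x1 - y1) + ?P (y1 - ?yb)"
        unfolding split by (rule linear_add[OF linP])
      ultimately have "?P (A *v dx) = ?P (A *v x1 - y1)" by simp
      then have pr: "p dx \<le> (norm (A *v x1 - y1))\<^sup>2"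
        unfolding p_def using P(2)[of "A *v x1 - y1"] by (simp add: power_mono)
      obtain G1 where G1: "g y1 = ereal G1"
        using subdiff_finite[OF l1sub] by (cases "g y1") auto
      have segment: "x \<in> ball xbar \<delta>" if "x \<in> closed_segment xbar x1" for x
        using that closed_segment_subset[of xbar "ball xbar \<delta>" x1] x1X d(1) by auto
      \<comment> \<open>\<open>f\<close> penalized by \<open>\<beta>0 / 2 * p\<close> is convex on the segment, although \<open>f\<close> itself may not be\<close>
      have "f x1 - f xbar \<le> gradf x1 \<bullet> (x1 - xbar) + (\<beta>0 * p dx) / 2"
      proof (rule local_gradient_inequality[OF assms(4), where H = "\<lambda>x v. hessf x *v v"])
        fix x assume x: "x \<in> closed_segment xbar x1"
        show "(gradf has_derivative (*v) (hessf x)) (at x)"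
          using segment[OF x] d(3) d2(2) by (intro assms(12)) auto
        have "dx \<in> parallel_space C"
          using x1C xbC unfolding dx_def parallel_space_def by (auto intro: hull_inc)
        then show "0 \<le> (x1 - xbar) \<bullet> (hessf x *v (x1 - xbar)) + \<beta>0 * p dx"
          using hess[of x dx] segment[OF x] d(2) by (simp add: dx_def dist_commute)
      qed
      moreover
      have "(gradf x1 + transpose A *v (lk + \<beta> *\<^sub>R (A *v x1 - yk))) \<bullet> (xbar - x1) \<ge> 0"
        by (rule first_order_variational_inequality[OF x1 assms(3) xbC
              augmented_lagrangian_gradient[OF assms(4)]])
      moreover have "lk + \<beta> *\<^sub>R (A *v x1 - yk) = l1 + \<beta> *\<^sub>R (y1 - yk)"
        by (simp add: l1 algebra_simps)
      moreover have adj: "v \<bullet> (transpose A *v w) = w \<bullet> (A *v v)" for v w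
        by (metis dot_lmul_matrix inner_commute transpose_matrix_vector)
      ultimately have fstep: "f x1 - f xbar
          \<le> - ((l1 + \<beta> *\<^sub>R (y1 - yk)) \<bullet> (A *v x1 - ?yb)) + \<beta>0 / 2 * p dx"
        by (simp add: inner_add_left inner_commute[of "transpose A *v _"] inner_diff_right
            matrix_vector_mult_diff_distrib del: transpose_matrix_vector)
      have gstep: "G1 - G0 \<le> l1 \<bullet> (y1 - ?yb)"
        using subdiff_realD[OF l1sub subdiff_finite[OF lb]] by (simp add: G0 G1 inner_diff_right)
      have quad: "(x1 - xbar) \<bullet> (transpose A *v ?P (A *v (x1 - xbar))) = p dx"
        unfolding adj p_def dx_def[symmetric] P(1)[symmetric] by (rule inner_commute)
      have "ereal (f xbar + G0) \<le> reduced_aug_lagrangian f g A C \<beta>0 xbar lbar"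
        by (rule reduced_aug_lagrangian_ge[OF b0 xbC lb G0])
      \<comment> \<open>\<open>ls\<close> maximizes over a neighbourhood that contains \<open>lbar\<close>\<close>
      also have "\<dots> \<le> reduced_aug_lagrangian f g A C \<beta>0 xbar ls"
        using saddle eps(1) d(1) unfolding saddle_point_def by (metis centre_in_ball half_gt_zero)
      finally have low: "ereal (f xbar + G0) \<le> reduced_aug_lagrangian f g A C \<beta>0 xbar ls" .
      have "reduced_aug_lagrangian f g A C \<beta>0 x1 ls - reduced_aug_lagrangian f g A C \<beta>0 xbar ls
          + ereal ((\<theta> * \<beta> - \<beta>0) / 2 * p dx)
          \<le> ereal (f x1 + G1 + ls \<bullet> (A *v x1 - y1) + \<beta>0 / 2 * (norm (A *v x1 - y1))\<^sup>2)
            - ereal (f xbar + G0) + ereal ((\<theta> * \<beta> - \<beta>0) / 2 * p dx)"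
        by (intro add_right_mono ereal_minus_mono low reduced_aug_lagrangian_le[where g = g and y = y1, OF b0 x1C G1])
      also have "\<dots> \<le> ereal (\<beta> / 2 * ((norm (yk - ?yb))\<^sup>2 - (norm (y1 - ?yb))\<^sup>2)
            + 1 / (2 * \<beta>) * ((norm (lk - ls))\<^sup>2 - (norm (l1 - ls))\<^sup>2)
            - \<beta> / 2 * (norm (y1 - yk))\<^sup>2
            - ((1 - \<theta>) * \<beta> - \<beta>0) / (2 * \<beta>\<^sup>2) * (norm (l1 - lk))\<^sup>2)"
        using admm_descent_inequality[OF b th fstep gstep subdiff_monotone[OF l1sub lksub] l1 pr, of ls]
        by simp
      finally show "reduced_aug_lagrangian f g A C \<beta>0 x1 ls - reduced_aug_lagrangian f g A C \<beta>0 xbar ls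
          + ereal ((\<theta> * \<beta> - \<beta>0) / 2 * ((x1 - xbar) \<bullet> (transpose A *v ?P (A *v (x1 - xbar)))))
        \<le> ereal (\<beta> / 2 * ((norm (yk - ?yb))\<^sup>2 - (norm (y1 - ?yb))\<^sup>2)
            + 1 / (2 * \<beta>) * ((norm (lk - ls))\<^sup>2 - (norm (l1 - ls))\<^sup>2)
            - \<beta> / 2 * (norm (y1 - yk))\<^sup>2
            - ((1 - \<theta>) * \<beta> - \<beta>0) / (2 * \<beta>\<^sup>2) * (norm (l1 - lk))\<^sup>2)"
        unfolding quad .
    qed
  qed
qed

end
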